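(* Let $p,q$ be coprime integers with $|p|+|q|>2$ and let $n\ge1$. Let $A=\mathrm{diag}(\lambda_1,\dots,\lambda_n)$, where the $\lambda_i$ are non-zero and pairwise distinct complex numbers, be such that $A^p$ and $A^q$ are similar, and assume that the eigenvalues form a single cycle in the given order, i.e. $\lambda_u^q=\lambda_{u+1}^p$ for all $1\le u\le n$, where $\lambda_{n+1}:=\lambda_1$. Let $R=\mathbb{Z}/(q^n-p^n)\mathbb{Z}$. Then there exists $$k_1\in R\setminus\bigcup_{z\mid n,\;1\le z<n}\left(\frac{q^n-p^n}{q^z-p^z}\right)R$$ such that, for every $1\le u\le n$, $\lambda_u=\exp\left(\dfrac{2i\pi k_u}{q^n-p^n}\right)$, where $k_u=(p^{-1}q)^{u-1}k_1\in R$.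
   Context: Since $\gcd(p,q)=1$ and $|p|+|q|>2$, one has $q^z\neq p^z$ for every $z\ge 1$, and $p$ is invertible in $R=\mathbb{Z}/(q^n-p^n)\mathbb{Z}$; $p^{-1}$ denotes its inverse in $R$. For $k\in R$, $\exp(2i\pi k/(q^n-p^n))$ means the value at any integer representative of $k$ (it does not depend on the representative). *)

theory Defs
  imports "HOL-Analysis.Complex_Transcendental" "HOL-Algebra.IntRing" "Jordan_Normal_Form.Matrix"
begin

text \<open>
  Elements of \<^term>\<open>ZFact N\<close> are cosets of \<open>N\<int>\<close>, i.e. sets of integers; \<^term>\<open>ZMod N a\<close> is the
  class of \<open>a\<close>.  For a class \<open>k\<close> the following is the common value of \<open>exp (2\<pi>im / N)\<close> at all
  representatives \<open>m \<in> k\<close>; lemma \<open>exp_class_eq\<close> shows that it is well defined.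
\<close>

definition exp_class :: "int \<Rightarrow> int set \<Rightarrow> complex" where
  "exp_class N k =
    the_elem ((\<lambda>m. exp (2 * \<i> * complex_of_real pi * of_int m / of_int N)) ` k)"

lemma exp_class_eq:
  assumes "N \<noteq> 0" and k: "k \<in> carrier (ZFact N)" and m: "m \<in> k"
  shows "exp_class N k = exp (2 * \<i> * complex_of_real pi * of_int m / of_int N)"
proof -
  let ?c = "2 * \<i> * complex_of_real pi"
  obtain a where a: "k = ZMod N a"
    using k by (auto simp: ZFact_def FactRing_def A_RCOSETS_def' ZMod_def)
  have eq: "exp (?c * of_int j / of_int N) = exp (?c * of_int m / of_int N)" if j: "j \<in> k" for j
  proof -
    obtain x y where x: "j = x * N + a" and y: "m = y * N + a"
      using rcos_zfact j m a by meson
    have "(of_int j :: complex) = of_int m + of_int (x - y) * of_int N"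
      by (simp add: x y left_diff_distrib)
    then have "?c * of_int j / of_int N
        = ?c * of_int m / of_int N + ?c * of_int (x - y)"
      using \<open>N \<noteq> 0\<close> by (simp add: distrib_left add_divide_distrib)
    also have "?c * of_int (x - y) = \<i> * (of_int (x - y) * (of_real pi * 2))"
      by (simp only: mult_ac)
    finally show ?thesis
      by (simp only: exp_plus_2pin)
  qed
  have "(\<lambda>j. exp (?c * of_int j / of_int N)) ` k = {exp (?c * of_int m / of_int N)}"
  proof (intro equalityI subsetI)
    fix w assume "w \<in> (\<lambda>j. exp (?c * of_int j / of_int N)) ` k"
    then obtain j where "j \<in> k" "w = exp (?c * of_int j / of_int N)"
      by (rule imageE)
    then show "w \<in> {exp (?c * of_int m / of_int N)}"
      using eq by (metis singletonI)
  next
    fix w assume "w \<in> {exp (?c * of_int m / of_int N)}"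
    then have "w = exp (?c * of_int m / of_int N)"
      by (rule singletonD)
    then show "w \<in> (\<lambda>j. exp (?c * of_int j / of_int N)) ` k"
      using m by (rule image_eqI)
  qed
  then show ?thesis
    by (simp only: exp_class_def the_elem_eq)
qed

end

theory Submission
  imports Defs
begin

text \<open>
  Following the chain \<open>\<lambda>\<^sub>u\<^sup>q = \<lambda>\<^sub>u\<^sub>+\<^sub>1\<^sup>p\<close> for \<open>z\<close> steps gives \<open>\<lambda>\<^sub>u\<close> to the power \<open>q ^ z\<close> equal to
  \<open>\<lambda>\<^sub>u\<^sub>+\<^sub>z\<close> to the power \<open>p ^ z\<close>; once around the cycle this makes every \<open>\<lambda>\<^sub>u\<close> an \<open>N\<close>-th root of
  unity, where \<open>N = q ^ n - p ^ n\<close>.  Since \<open>p\<close> is prime to \<open>N\<close>, an \<open>N\<close>-th root of unity is determined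
  by its \<open>p\<close>-th power, so \<open>\<lambda>\<^sub>1\<close> determines all \<open>\<lambda>\<^sub>u\<close>.  If \<open>k\<^sub>1\<close> were a multiple of
  \<open>N div (q ^ z - p ^ z)\<close>, then \<open>\<lambda>\<^sub>1\<close> would have equal powers with exponents \<open>q ^ z\<close> and \<open>p ^ z\<close>, hence
  \<open>\<lambda>\<^sub>1\<^sub>+\<^sub>z = \<lambda>\<^sub>1\<close>, against distinctness.
\<close>

section \<open>Roots of unity and integer powers\<close>

definition unity_exp :: "int \<Rightarrow> int \<Rightarrow> complex" where
  "unity_exp N a = exp (2 * \<i> * complex_of_real pi * of_int a / of_int N)"

lemma unity_exp_powi: "unity_exp N a powi m = unity_exp N (m * a)"
  by (simp add: unity_exp_def exp_power_int mult_ac)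

lemma unity_exp_eqI:
  assumes "N dvd a - b"
  shows "unity_exp N a = unity_exp N b"
proof (cases "N = 0")
  case False
  obtain c where "a = b + N * c"
    using assms by (metis dvdE diff_add_cancel add.commute)
  then have "2 * \<i> * complex_of_real pi * of_int a / of_int N
      = 2 * \<i> * complex_of_real pi * of_int b / of_int N + (of_int (2 * c) * pi) * \<i>"
    using False by (simp add: field_simps)
  then show ?thesis
    unfolding unity_exp_def exp_eq by blast
\<comment> \<open>For \<open>N = 0\<close> both quotients are 0 by the convention for division by
  zero.\<close>
qed (simp add: unity_exp_def)

lemma unity_exp_powi_self: "unity_exp N a powi N = 1"
proof -
  have "unity_exp N (N * a) = unity_exp N 0"
    by (rule unity_exp_eqI) simp
  then show ?thesis
    by (simp add: unity_exp_powi) (simp add: unity_exp_def)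
qed

text \<open>\<open>N * Ln w\<close> is a logarithm of 1, hence an integer multiple of
  \<open>2 * pi * \<i>\<close>; dividing by \<open>N\<close> gives the exponent. \<open>N\<close>
  may be negative.\<close>

lemma root_of_unity_eq_unity_exp:
  assumes "N \<noteq> 0" and w: "w powi N = 1"
  obtains a where "w = unity_exp N a"
proof -
  have "w \<noteq> 0"
    using assms by auto
  then have "exp (of_int N * Ln w) = exp 0"
    using w by (simp flip: exp_power_int)
  then obtain a :: int where "of_int N * Ln w = 0 + (of_int (2 * a) * pi) * \<i>"
    unfolding exp_eq by blast
  then have "Ln w = 2 * \<i> * complex_of_real pi * of_int a / of_int N"
    using \<open>N \<noteq> 0\<close> by (simp add: field_simps)
  then have "w = unity_exp N a"
    using \<open>w \<noteq> 0\<close> unfolding unity_exp_def by (metis exp_Ln)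
  then show thesis
    by (rule that)
qed

text \<open>By Bezout, \<open>w\<close> can be rebuilt from \<open>w powi m\<close> and
  \<open>w powi N\<close>; the Bezout coefficients may be negative, hence the non-zero
  bases.\<close>

lemma coprime_powi_inj:
  fixes x y :: "'a :: field" and m N :: int
  assumes "x \<noteq> 0" "y \<noteq> 0" "coprime m N"
    and N: "x powi N = y powi N" and m: "x powi m = y powi m"
  shows "x = y"
proof -
  obtain u v where "u * m + v * N = 1"
    using bezout_int[of m N] \<open>coprime m N\<close> by auto
  then have uv: "m * u + N * v = 1"
    by (simp add: mult.commute)
  have eq: "w = (w powi m) powi u * (w powi N) powi v" if "w \<noteq> 0" for w :: 'a
  proof -
    have "w = w powi (m * u + N * v)"
      by (simp add: uv)
    also have "\<dots> = (w powi m) powi u * (w powi N) powi v"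
      using that by (simp add: power_int_add power_int_mult)
    finally show ?thesis .
  qed
  show ?thesis
    using eq[OF \<open>x \<noteq> 0\<close>] eq[OF \<open>y \<noteq> 0\<close>] N m by simp
qed

text \<open>Each step trades one factor \<open>q\<close> of the exponent for a factor
  \<open>p\<close> and moves one index on, as exponents commute.\<close>

lemma powi_chain:
  fixes f :: "nat \<Rightarrow> 'a :: field"
  assumes "\<And>j. f j powi q = f (Suc j) powi p"
  shows "f i powi (q ^ k) = f (i + k) powi (p ^ k)"
proof (induction k)
  case (Suc k)
  have "f i powi (q ^ Suc k) = (f (i + k) powi (p ^ k)) powi q"
    by (simp add: Suc.IH[symmetric] power_int_mult[symmetric] mult.commute)
  also have "\<dots> = (f (i + k) powi q) powi (p ^ k)"
    by (simp add: power_int_mult[symmetric] mult.commute)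
  also have "\<dots> = f (i + Suc k) powi (p ^ Suc k)"
    by (simp add: assms power_int_mult[symmetric])
  finally show ?case .
qed simp

section \<open>Arithmetic of \<open>q ^ n - p ^ n\<close>\<close>

lemma coprime_power_diff:
  fixes p q :: int
  assumes "coprime p q" "n \<ge> 1"
  shows "coprime p (q ^ n - p ^ n)"
proof (rule coprimeI)
  fix c assume c: "c dvd p" "c dvd q ^ n - p ^ n"
  then have "c dvd p ^ n"
    using assms(2) by (auto intro: dvd_trans[of c p] simp: dvd_power)
  then have "c dvd q ^ n"
    using dvd_add[OF c(2), of "p ^ n"] by simp
  then show "is_unit c"
    using assms(1) c(1) by (meson coprime_common_divisor coprime_power_right_iff)
qed

text \<open>Equal powers force equal absolute values; coprimality then makes both 1, with sum only
  2.\<close>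

lemma power_diff_neq_0:
  fixes p q :: int
  assumes "coprime p q" "\<bar>p\<bar> + \<bar>q\<bar> > 2" "n \<ge> 1"
  shows "q ^ n - p ^ n \<noteq> 0"
proof
  assume "q ^ n - p ^ n = 0"
  then have "\<bar>q\<bar> ^ n = \<bar>p\<bar> ^ n"
    by (simp flip: power_abs)
  then have eq: "\<bar>q\<bar> = \<bar>p\<bar>"
    using assms(3) by (simp add: power_eq_iff_eq_base)
  then have "is_unit p"
    using assms(1) by (metis abs_dvd_iff coprime_common_divisor dvd_abs_iff dvd_refl)
  then show False
    using eq assms(2) by simp
qed

text \<open>With \<open>n = z * m\<close>, \<open>x ^ m - y ^ m\<close> is divisible by
  \<open>x - y\<close> for \<open>x = q ^ z\<close>, \<open>y = p ^ z\<close>.\<close>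

lemma power_diff_dvd:
  fixes p q :: "'a :: comm_ring_1"
  assumes "z dvd n"
  shows "q ^ z - p ^ z dvd q ^ n - p ^ n"
proof -
  obtain m where "n = z * m"
    using assms by blast
  then show ?thesis
    by (simp add: power_mult power_diff_sumr2)
qed

section \<open>Computing in the residue ring with integer representatives\<close>

lemma ZMod_ring_hom: "ring_hom_cring \<Z> (ZFact N) (ZMod N)"
proof -
  interpret I: ideal "Idl\<^bsub>\<Z>\<^esub> {N}" \<Z>
    by (rule int.genideal_ideal) simp
  have "ring_hom_cring \<Z> (\<Z> Quot Idl\<^bsub>\<Z>\<^esub> {N}) ((+>\<^bsub>\<Z>\<^esub>) (Idl\<^bsub>\<Z>\<^esub> {N}))"
    by (rule I.rcos_ring_hom_cring) (rule int_is_cring)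
  moreover have "ZMod N = (+>\<^bsub>\<Z>\<^esub>) (Idl\<^bsub>\<Z>\<^esub> {N})"
    by (simp add: fun_eq_iff ZMod_def)
  ultimately show ?thesis
    by (simp add: ZFact_def)
qed

lemma ZMod_closed: "ZMod N a \<in> carrier (ZFact N)"
proof -
  interpret ring_hom_cring \<Z> "ZFact N" "ZMod N"
    by (rule ZMod_ring_hom)
  show ?thesis
    by (rule hom_closed) simp
qed

lemma ZMod_mult: "ZMod N a \<otimes>\<^bsub>ZFact N\<^esub> ZMod N b = ZMod N (a * b)"
proof -
  interpret ring_hom_cring \<Z> "ZFact N" "ZMod N"
    by (rule ZMod_ring_hom)
  show ?thesis
    using hom_mult[of a b] by simp
qed

lemma ZMod_one: "\<one>\<^bsub>ZFact N\<^esub> = ZMod N 1"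
proof -
  interpret ring_hom_cring \<Z> "ZFact N" "ZMod N"
    by (rule ZMod_ring_hom)
  show ?thesis
    using hom_one by simp
qed

lemma ZMod_power: "ZMod N a [^]\<^bsub>ZFact N\<^esub> (k :: nat) = ZMod N (a ^ k)"
proof -
  interpret cring "ZFact N"
    by (rule ZFact_is_cring)
  show ?thesis
    by (induction k) (simp_all add: ZMod_one ZMod_mult mult.commute)
qed

lemma ZMod_inv:
  assumes "N dvd a * b - 1"
  shows "inv\<^bsub>ZFact N\<^esub> (ZMod N a) = ZMod N b"
proof -
  interpret cring "ZFact N"
    by (rule ZFact_is_cring)
  have "ZMod N a \<otimes>\<^bsub>ZFact N\<^esub> ZMod N b = \<one>\<^bsub>ZFact N\<^esub>"
    using assms by (simp add: ZMod_one ZMod_mult ZMod_eq_mod mod_eq_dvd_iff)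
  then show ?thesis
    by (intro comm_inv_char ZMod_closed)
qed

lemma ZFact_carrierE:
  assumes "k \<in> carrier (ZFact N)"
  obtains a where "k = ZMod N a"
  using assms by (auto simp: ZFact_def FactRing_def A_RCOSETS_def' ZMod_def)

lemma ZMod_in_PIdlE:
  assumes "ZMod N a \<in> PIdl\<^bsub>ZFact N\<^esub> (ZMod N d)"
  obtains c where "N dvd a - c * d"
proof -
  obtain x where "x \<in> carrier (ZFact N)" "ZMod N a = x \<otimes>\<^bsub>ZFact N\<^esub> ZMod N d"
    using assms unfolding cgenideal_def by blast
  then obtain c where "ZMod N a = ZMod N (c * d)"
    by (metis ZFact_carrierE ZMod_mult)
  then show thesis
    using that by (simp add: ZMod_eq_mod mod_eq_dvd_iff)
qed

lemma exp_class_ZMod: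
  assumes "N \<noteq> 0"
  shows "exp_class N (ZMod N a) = unity_exp N a"
proof -
  have "a \<in> ZMod N a"
    unfolding ZMod_def by (auto simp: a_r_coset_defs int_Idl)
  then show ?thesis
    unfolding unity_exp_def by (rule exp_class_eq[OF assms ZMod_closed])
qed

theorem theorem2:
  fixes p q N :: int and n :: nat and lam :: "nat \<Rightarrow> complex"
    and A :: "complex mat" and M :: "complex mat ring" and R :: "int set ring"
  assumes "coprime p q" and "\<bar>p\<bar> + \<bar>q\<bar> > 2" and "n \<ge> 1"
    and "\<forall>u\<in>{1..n}. lam u \<noteq> 0" and "inj_on lam {1..n}"
    and "A = mat_diag n (\<lambda>i. lam (i + 1))"
    and "M = ring_mat TYPE(complex) n ()"
    and "similar_mat (A [^]\<^bsub>M\<^esub> p) (A [^]\<^bsub>M\<^esub> q)"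
    and "lam (n + 1) = lam 1"
    and "\<forall>u\<in>{1..n}. lam u powi q = lam (u + 1) powi p"
    and "N = q ^ n - p ^ n" and "R = ZFact N"
  shows "\<exists>k1 \<in> carrier R - (\<Union>z\<in>{z. z dvd n \<and> 1 \<le> z \<and> z < n}.
            PIdl\<^bsub>R\<^esub> (ZMod N (N div (q ^ z - p ^ z)))).
          \<forall>u\<in>{1..n}. lam u = exp_class N
            ((inv\<^bsub>R\<^esub> (ZMod N p) \<otimes>\<^bsub>R\<^esub> ZMod N q) [^]\<^bsub>R\<^esub> (u - 1) \<otimes>\<^bsub>R\<^esub> k1)"
proof -
  note N = assms(11) and R = assms(12)
  \<comment> \<open>Indices are shifted to start at 0 and extended with period \<open>n\<close>, so
    the chain relation holds at every \<open>j\<close> without a special case.\<close>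
  define f where "f j = lam (j mod n + 1)" for j
  have lam: "lam u = f (u - 1)" if "u \<in> {1..n}" for u
  proof -
    have "(u - 1) mod n = u - 1"
      using that by (intro mod_less) auto
    then show ?thesis
      using that by (simp add: f_def)
  qed
  have f_nz: "f j \<noteq> 0" for j
    using assms(3,4) by (auto simp: f_def Suc_le_eq)
  have step: "f j powi q = f (Suc j) powi p" for j
  proof -
    \<comment> \<open>Where \<open>Suc j\<close> wraps around to 0 modulo \<open>n\<close>, this is
      \<open>lam (n + 1) = lam 1\<close>.\<close>
    have "f (Suc j) = lam (j mod n + 1 + 1)"
      using assms(9) by (simp add: f_def mod_Suc)
    moreover have "j mod n + 1 \<in> {1..n}"
      using assms(3) by (simp add: Suc_le_eq)
    ultimately show ?thesis
      using assms(10) by (simp add: f_def)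
  qed
  have N0: "N \<noteq> 0"
    unfolding N using assms(1-3) by (rule power_diff_neq_0)
  have cop: "coprime p N"
    unfolding N using assms(1,3) by (rule coprime_power_diff)
  have f_root: "f j powi N = 1" for j
  proof -
    have "f (j + n) = f j"
      by (simp add: f_def)
    then have "f j powi (q ^ n) = f j powi (p ^ n)"
      using powi_chain[of f q p, OF step, of j n] by simp
    then show ?thesis
      using f_nz[of j] by (simp add: N power_int_diff)
  qed
  \<comment> \<open>The class of \<open>a\<close> will be the witness \<open>k1\<close>.\<close>
  obtain a where a: "f 0 = unity_exp N a"
    using root_of_unity_eq_unity_exp[OF N0 f_root] by blast
  \<comment> \<open>\<open>b\<close> represents the inverse of \<open>p\<close> modulo
    \<open>N\<close>.\<close>
  obtain b where b: "N dvd p * b - 1"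
  proof -
    obtain u v where "u * p + v * N = 1"
      using bezout_int[of p N] cop by auto
    then have "p * u - 1 = N * (- v)"
      by (simp add: algebra_simps)
    then show thesis
      using that by (metis dvd_triv_left)
  qed
  have f_eq: "f j = unity_exp N ((b * q) ^ j * a)" for j
  proof (induction j)
    case (Suc j)
    let ?c = "(b * q) ^ j * a"
    let ?d = "(b * q) ^ Suc j * a"
    \<comment> \<open>Since \<open>p * b\<close> is 1 modulo \<open>N\<close>, the candidate with
      exponent \<open>?d\<close> has the same \<open>p\<close>-th power as \<open>f (Suc j)\<close>;
      both are \<open>N\<close>-th roots of unity, so they agree.\<close>
    have "p * ?d - q * ?c = (p * b - 1) * (q * ?c)"
      by (simp add: algebra_simps)
    then have "unity_exp N (p * ?d) = unity_exp N (q * ?c)"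
      using b by (intro unity_exp_eqI) simp
    also have "\<dots> = f j powi q"
      by (simp only: Suc.IH unity_exp_powi)
    also have "\<dots> = f (Suc j) powi p"
      by (rule step)
    finally have "f (Suc j) powi p = unity_exp N ?d powi p"
      by (simp only: unity_exp_powi)
    moreover have "f (Suc j) powi N = unity_exp N ?d powi N"
      by (simp only: f_root unity_exp_powi_self)
    moreover have "unity_exp N ?d \<noteq> 0"
      by (simp add: unity_exp_def)
    ultimately show ?case
      using f_nz cop by (metis coprime_powi_inj)
  qed (simp add: a)
  have "ZMod N a \<notin> PIdl\<^bsub>R\<^esub> (ZMod N (N div (q ^ z - p ^ z)))"
    if z: "z dvd n" "1 \<le> z" "z < n" for z
  proof
    let ?D = "q ^ z - p ^ z"
    assume "ZMod N a \<in> PIdl\<^bsub>R\<^esub> (ZMod N (N div ?D))"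
    then obtain c where c: "N dvd a - c * (N div ?D)"
      unfolding R by (rule ZMod_in_PIdlE)
    have "?D dvd N"
      unfolding N using z(1) by (rule power_diff_dvd)
    \<comment> \<open>The division is exact, so multiplying the congruence for \<open>a\<close> by
      \<open>?D\<close> gives \<open>N dvd ?D * a\<close>.\<close>
    then have "?D * (c * (N div ?D)) = N * c"
      by (metis dvd_mult_div_cancel mult.assoc mult.commute)
    then have "q ^ z * a - p ^ z * a = ?D * (a - c * (N div ?D)) + N * c"
      by (simp add: algebra_simps)
    then have "N dvd q ^ z * a - p ^ z * a"
      using c by simp
    then have "f 0 powi (q ^ z) = f 0 powi (p ^ z)"
      unfolding a unity_exp_powi by (rule unity_exp_eqI)
    moreover have "f 0 powi (q ^ z) = f z powi (p ^ z)"
      using powi_chain[of f q p, OF step, of 0 z] by simp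
    ultimately have eq: "f 0 powi (p ^ z) = f z powi (p ^ z)"
      by simp
    have "coprime (p ^ z) N" "f 0 powi N = f z powi N"
      using cop by (simp_all add: f_root)
    then have "f 0 = f z"
      using coprime_powi_inj[OF f_nz f_nz] eq by blast
    \<comment> \<open>\<open>z < n\<close> gives \<open>z mod n = z\<close>, so \<open>f z\<close>
      has not yet wrapped around.\<close>
    then have "lam 1 = lam (z + 1)"
      using z by (simp add: f_def)
    then show False
      using z assms(5) by (auto dest: inj_onD)
  qed
  moreover have "lam u = exp_class N
      ((inv\<^bsub>R\<^esub> (ZMod N p) \<otimes>\<^bsub>R\<^esub> ZMod N q) [^]\<^bsub>R\<^esub> (u - 1) \<otimes>\<^bsub>R\<^esub> ZMod N a)"
    if "u \<in> {1..n}" for u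
    using lam[OF that] f_eq
    by (simp add: R ZMod_inv[OF b] ZMod_mult ZMod_power exp_class_ZMod[OF N0])
  moreover have "ZMod N a \<in> carrier R"
    unfolding R by (rule ZMod_closed)
  ultimately show ?thesis
    by (intro bexI[of _ "ZMod N a"]) blast+
qed

end
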